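(* For every $n\ge2$ and every $p>1$, there exist two convex bodies $K$ and $K'$ in $\mathbb R^n$ such that $0\in\operatorname{int}(K\cap K')$ and $F_p(K)<F_p(K')$.
   Context: A convex body is a non-empty compact convex subset of $\mathbb R^n$; its support function is $h_K(x)=\sup_{y\in K}(x,y)$, where $(\cdot,\cdot)$ is the Euclidean scalar product. For a convex body $K$ with the origin in its interior and $p>1$, $$F_p(K)=\int_{\mathbb R^n}|\nabla h_K(x)|^p\,e^{-h_K(x)}\,dx .$$ *)

theory Defs
  imports "HOL-Analysis.Analysis"
begin

definition convex_body :: "'a::euclidean_space set \<Rightarrow> bool" where
  "convex_body K \<longleftrightarrow> K \<noteq> {} \<and> compact K \<and> convex K"

definition support_function :: "'a::euclidean_space set \<Rightarrow> 'a \<Rightarrow> real" where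
  "support_function K x = (SUP y\<in>K. x \<bullet> y)"

(* Unspecified where f is not differentiable; the support function of a convex body is
   Lipschitz, hence differentiable almost everywhere. *)
definition gradient :: "('a::euclidean_space \<Rightarrow> real) \<Rightarrow> 'a \<Rightarrow> 'a" where
  "gradient f x = (THE D. GDERIV f x :> D)"

(* The integrand is nonnegative, so its Lebesgue integral is taken in [0, \<infinity>], which needs no
   convention for the non-integrable case.  It is finite when K is a convex body with 0 in
   its interior. *)
definition F_functional :: "real \<Rightarrow> 'a::euclidean_space set \<Rightarrow> ennreal" where
  "F_functional p K =
     (\<integral>\<^sup>+ x. ennreal (norm (gradient (support_function K) x) powr p * exp (- support_function K x))
        \<partial>lebesgue)"

end

theory Submission
  imports Defs
begin

text \<open>
  For an ellipsoid \<open>E = A B\<close>, the image of the unit ball \<open>B\<close> under a positive diagonal map \<open>A\<close>, one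
  has \<open>h(x) = |A x|\<close> and \<open>\<nabla>h(x) = A (A x / |A x|)\<close>.  The linear substitution \<open>y = A x\<close> therefore turns
  the functional into an integral in which only the gradient factor depends on \<open>A\<close>:
  \<open>det A * F\<^sub>p(E) = \<integral> |A (y / |y|)|\<^sup>p exp (- |y|) dy\<close>  (lemma \<open>F_functional_ellipsoid\<close>).

  Stretch a single axis \<open>e\<close> by the factor \<open>a\<close>, so that \<open>det A = a\<close>.  Since \<open>|A u| \<ge> a |u \<bullet> e|\<close>, the formula
  gives \<open>F\<^sub>p(E) \<ge> a\<^bsup>p-1\<^esup> I\<close>, where \<open>I = \<integral> |(y / |y|) \<bullet> e|\<^sup>p exp (- |y|) dy\<close> does not depend on \<open>a\<close> and is
  positive because the integrand vanishes only on a hyperplane.  As \<open>p > 1\<close>, this bound is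
  unbounded in \<open>a\<close>, whereas for the unit ball \<open>F\<^sub>p(B) = \<integral> exp (- |y|) dy\<close> is finite.  So the unit ball and
  a sufficiently elongated ellipsoid form the required pair.
\<close>

section \<open>Ellipsoids with coordinate axes\<close>

definition diagonal_map :: "('a::euclidean_space \<Rightarrow> real) \<Rightarrow> 'a \<Rightarrow> 'a" where
  "diagonal_map c x = (\<Sum>j\<in>Basis. (c j * (x \<bullet> j)) *\<^sub>R j)"

lemma diagonal_map_inner_Basis [simp]:
  "j \<in> Basis \<Longrightarrow> diagonal_map c x \<bullet> j = c j * (x \<bullet> j)"
  unfolding diagonal_map_def by (simp add: inner_sum_left inner_Basis if_distrib cong: if_cong)

lemma linear_diagonal_map: "linear (diagonal_map c)"
  by (rule linearI; rule euclidean_eqI) (simp_all add: algebra_simps)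

lemma diagonal_map_self_adjoint: "diagonal_map c x \<bullet> y = x \<bullet> diagonal_map c y"
  by (simp add: euclidean_inner [of "diagonal_map c x" y] euclidean_inner [of x "diagonal_map c y"]
      mult_ac)

lemma diagonal_map_eq_0_iff:
  fixes x :: "'a::euclidean_space"
  assumes "\<And>j. j \<in> Basis \<Longrightarrow> c j \<noteq> 0"
  shows "diagonal_map c x = 0 \<longleftrightarrow> x = 0"
  using assms by (simp add: euclidean_eq_iff [where 'a = 'a])

lemma diagonal_map_one [simp]: "diagonal_map (\<lambda>_. 1) x = x"
  by (rule euclidean_eqI) simp

definition ellipsoid :: "('a::euclidean_space \<Rightarrow> real) \<Rightarrow> 'a set" where
  "ellipsoid c = diagonal_map c ` cball 0 1"

lemma convex_body_ellipsoid: "convex_body (ellipsoid c)"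
proof -
  have "continuous_on (cball 0 1) (diagonal_map c)"
    using linear_diagonal_map[of c] by (simp add: linear_continuous_on linear_linear)
  then show ?thesis
    unfolding convex_body_def ellipsoid_def
    by (simp add: compact_continuous_image convex_linear_image linear_diagonal_map)
qed

lemma zero_in_interior_ellipsoid:
  assumes "\<And>j. j \<in> Basis \<Longrightarrow> c j \<noteq> 0"
  shows "0 \<in> interior (ellipsoid c)"
proof -
  have "inj (diagonal_map c)"
    by (simp add: linear_injective_0 linear_diagonal_map diagonal_map_eq_0_iff[OF assms])
  then have "interior (ellipsoid c) = diagonal_map c ` interior (cball 0 1)"
    unfolding ellipsoid_def by (intro interior_injective_linear_image linear_diagonal_map)
  moreover have "0 = diagonal_map c 0"
    by (simp add: diagonal_map_def)
  ultimately show ?thesis by simp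
qed

text \<open>
  Self-adjointness moves \<open>A\<close> to the other side of the inner product: \<open>x \<bullet> A z = A x \<bullet> z\<close>, which
  Cauchy-Schwarz bounds by \<open>|A x|\<close> on the unit ball, with equality at the direction of \<open>A x\<close>.
\<close>

lemma support_function_ellipsoid: "support_function (ellipsoid c) x = norm (diagonal_map c x)"
proof -
  have "diagonal_map c x \<bullet> sgn (diagonal_map c x) = norm (diagonal_map c x)"
    by (cases "diagonal_map c x = 0") (simp_all add: sgn_div_norm dot_square_norm power2_eq_square)
  then have attained: "norm (diagonal_map c x) \<in> (\<lambda>y. x \<bullet> y) ` ellipsoid c"
    unfolding ellipsoid_def image_image
    by (intro image_eqI[of _ _ "sgn (diagonal_map c x)"])
       (simp_all add: norm_sgn diagonal_map_self_adjoint [of c x])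
  have "x \<bullet> diagonal_map c z \<le> norm (diagonal_map c x)" if "norm z \<le> 1" for z
  proof -
    have "x \<bullet> diagonal_map c z \<le> norm (diagonal_map c x) * norm z"
      unfolding diagonal_map_self_adjoint [symmetric] by (rule norm_cauchy_schwarz)
    also have "\<dots> \<le> norm (diagonal_map c x)"
      using that by (simp add: mult_left_le)
    finally show ?thesis .
  qed
  then show ?thesis
    unfolding support_function_def
    by (intro cSup_eq_maximum attained) (auto simp: ellipsoid_def)
qed

section \<open>The functional on ellipsoids\<close>

lemma gradient_eqI: "GDERIV f x :> D \<Longrightarrow> gradient f x = D"
  unfolding gradient_def
proof (rule the_equality)
  fix D' assume "GDERIV f x :> D" "GDERIV f x :> D'"
  then have "(\<lambda>h. h \<bullet> D') = (\<lambda>h. h \<bullet> D)"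
    unfolding gderiv_def by (auto intro: has_derivative_unique)
  then show "D' = D"
    by (auto simp: fun_eq_iff vector_eq_ldot)
qed

text \<open>
  The norm has gradient \<open>sgn v\<close> at every \<open>v \<noteq> 0\<close>, so the chain rule gives the differential
  \<open>k \<mapsto> A k \<bullet> sgn (A x)\<close> of \<open>x \<mapsto> |A x|\<close>; transposing \<open>A\<close> once more exhibits the gradient.
\<close>

lemma gradient_support_function_ellipsoid:
  assumes "diagonal_map c x \<noteq> 0"
  shows "gradient (support_function (ellipsoid c)) x = diagonal_map c (sgn (diagonal_map c x))"
proof (rule gradient_eqI)
  have "(diagonal_map c has_derivative diagonal_map c) (at x)"
    using linear_diagonal_map[of c] by (simp add: bounded_linear_imp_has_derivative linear_linear)
  moreover have "(norm has_derivative (\<lambda>h. h \<bullet> sgn (diagonal_map c x))) (at (diagonal_map c x))"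
    using GDERIV_norm[OF assms] by (simp add: gderiv_def)
  ultimately have "((\<lambda>x. norm (diagonal_map c x)) has_derivative
      (\<lambda>h. diagonal_map c h \<bullet> sgn (diagonal_map c x))) (at x)"
    by (rule has_derivative_compose)
  then show "GDERIV (support_function (ellipsoid c)) x :> diagonal_map c (sgn (diagonal_map c x))"
    by (simp add: gderiv_def support_function_ellipsoid[abs_def] diagonal_map_self_adjoint)
qed

lemma borel_measurable_diagonal_map [measurable]: "diagonal_map c \<in> borel_measurable borel"
  unfolding diagonal_map_def[abs_def] by measurable

lemma borel_measurable_sgn_euclidean [measurable]:
  "(sgn :: 'a::euclidean_space \<Rightarrow> 'a) \<in> borel_measurable borel"
  unfolding sgn_div_norm[abs_def] by measurable

lemma nn_integral_diagonal_map:
  fixes f :: "'a::euclidean_space \<Rightarrow> ennreal"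
  assumes c: "\<And>j. j \<in> Basis \<Longrightarrow> c j \<noteq> 0" and [measurable]: "f \<in> borel_measurable borel"
  shows "(\<integral>\<^sup>+ y. f y \<partial>lborel)
    = ennreal (\<Prod>j\<in>Basis. \<bar>c j\<bar>) * (\<integral>\<^sup>+ x. f (diagonal_map c x) \<partial>lborel)"
proof -
  have "lborel = density (distr lborel borel (diagonal_map c)) (\<lambda>_. ennreal (\<Prod>j\<in>Basis. \<bar>c j\<bar>))"
    using lborel_affine_euclidean[where t = 0 and c = c, OF c]
    by (simp add: diagonal_map_def[abs_def])
  then have "(\<integral>\<^sup>+ y. f y \<partial>lborel)
      = (\<integral>\<^sup>+ y. f y \<partial>density (distr lborel borel (diagonal_map c)) (\<lambda>_. ennreal (\<Prod>j\<in>Basis. \<bar>c j\<bar>)))"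
    by (rule arg_cong)
  also have "\<dots> = ennreal (\<Prod>j\<in>Basis. \<bar>c j\<bar>) * (\<integral>\<^sup>+ x. f (diagonal_map c x) \<partial>lborel)"
    by (simp add: nn_integral_density nn_integral_distr nn_integral_cmult)
  finally show ?thesis .
qed

text \<open>
  The substitution \<open>y = A x\<close> makes the exponential weight independent of \<open>A\<close>, and it needs no polar
  coordinates.  The determinant stands on the left because division is awkward in \<open>[0, \<infinity>]\<close>.
\<close>

lemma F_functional_ellipsoid:
  fixes c :: "'a::euclidean_space \<Rightarrow> real"
  assumes c: "\<And>j. j \<in> Basis \<Longrightarrow> c j \<noteq> 0"
  shows "ennreal (\<Prod>j\<in>Basis. \<bar>c j\<bar>) * F_functional p (ellipsoid c)
    = (\<integral>\<^sup>+ y. ennreal (norm (diagonal_map c (sgn y)) powr p * exp (- norm y)) \<partial>lborel)"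
proof -
  define f :: "'a \<Rightarrow> ennreal"
    where "f y = ennreal (norm (diagonal_map c (sgn y)) powr p * exp (- norm y))" for y
  have [measurable]: "f \<in> borel_measurable borel"
    unfolding f_def by measurable
  \<comment> \<open>At the origin the support function has no gradient; a single point is negligible.\<close>
  have "AE x in lebesgue. x \<noteq> (0::'a)"
    by (rule AE_completion) (rule AE_lborel_singleton)
  then have "F_functional p (ellipsoid c) = (\<integral>\<^sup>+ x. f (diagonal_map c x) \<partial>lebesgue)"
    unfolding F_functional_def f_def
    by (intro nn_integral_cong_AE, elim eventually_mono)
       (simp add: support_function_ellipsoid gradient_support_function_ellipsoid
          diagonal_map_eq_0_iff[OF c])
  also have "\<dots> = (\<integral>\<^sup>+ x. f (diagonal_map c x) \<partial>lborel)"
    by (rule nn_integral_completion)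
  finally show ?thesis
    using nn_integral_diagonal_map[where f = f, OF c] by (simp add: f_def)
qed

section \<open>Finiteness and positivity of the integrals\<close>

lemma power_div_fact_le_exp:
  assumes "0 \<le> (x::real)"
  shows "x ^ n / fact n \<le> exp x"
  using sum_le_suminf[OF summable_exp_generic[of x], of "{n}"] assms
  by (simp add: exp_def divide_inverse mult.commute)

text \<open>
  On the shell \<open>k \<le> |x| < k + 1\<close> the integrand is at most \<open>exp (- k)\<close>, and the shell lies in a ball
  whose volume is polynomial in \<open>k\<close>; the resulting series converges.
\<close>

lemma nn_integral_exp_minus_norm_finite:
  "(\<integral>\<^sup>+ x. ennreal (exp (- norm (x::'a::euclidean_space))) \<partial>lborel) < \<infinity>"
proof -
  define n where "n = DIM('a)"
  define u where "u k = exp (- real k) * (unit_ball_vol (real n) * real (Suc k) ^ n)" for k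
  have u_nonneg: "u k \<ge> 0" for k
    by (simp add: u_def)
  have layer: "ennreal (exp (- norm x))
      \<le> (\<Sum>k. ennreal (exp (- real k)) * indicator (ball 0 (real (Suc k))) x)" for x :: 'a
  proof -
    define k where "k = nat \<lfloor>norm x\<rfloor>"
    have k: "real k \<le> norm x" "norm x < real (Suc k)"
      using floor_correct[of "norm x"] by (simp_all add: k_def add.commute)
    then have "ennreal (exp (- norm x))
        \<le> ennreal (exp (- real k)) * indicator (ball 0 (real (Suc k))) x"
      by (simp add: ennreal_leI)
    also have "\<dots> = (\<Sum>i\<in>{k}. ennreal (exp (- real i)) * indicator (ball 0 (real (Suc i))) x)"
      by (subst sum.insert) simp_all
    also have "\<dots> \<le> (\<Sum>k. ennreal (exp (- real k)) * indicator (ball 0 (real (Suc k))) x)"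
      by (rule sum_le_suminf) auto
    finally show ?thesis .
  qed
  have "summable (\<lambda>k. real (Suc k) ^ n * exp (- real k))"
  proof (rule summable_comparison_test)
    have "real (Suc k) ^ n * exp (- real k) \<le> (2 ^ n * fact n * exp (1/2)) * exp (- 1/2) ^ k" for k
    proof -
      \<comment> \<open>Half of the exponential decay absorbs the polynomial, by \<open>t\<^sup>n / n! \<le> exp t\<close> at \<open>t = (k + 1) / 2\<close>;
        the other half leaves a geometric series.\<close>
      have "(real (Suc k) / 2) ^ n / fact n \<le> exp (real (Suc k) / 2)"
        by (rule power_div_fact_le_exp) simp
      then have "real (Suc k) ^ n \<le> 2 ^ n * fact n * exp (real (Suc k) / 2)"
        by (simp add: field_simps power_divide)
      then have "real (Suc k) ^ n * exp (- real k)
          \<le> 2 ^ n * fact n * exp (real (Suc k) / 2) * exp (- real k)"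
        by (intro mult_right_mono) auto
      also have "\<dots> = 2 ^ n * fact n * exp (real (Suc k) / 2 - real k)"
        by (simp add: mult.assoc flip: exp_add)
      also have "real (Suc k) / 2 - real k = 1/2 + real k * (- 1/2)"
        by (simp add: field_simps)
      finally show ?thesis
        by (simp only: exp_add exp_of_nat_mult mult.assoc)
    qed
    then show "\<exists>N. \<forall>k\<ge>N. norm (real (Suc k) ^ n * exp (- real k))
        \<le> (2 ^ n * fact n * exp (1/2)) * exp (- 1/2) ^ k"
      by simp
    show "summable (\<lambda>k. (2 ^ n * fact n * exp (1/2)) * exp (- 1/2 :: real) ^ k)"
      by (intro summable_mult summable_geometric) simp
  qed
  from summable_mult[OF this, of "unit_ball_vol (real n)"] have "summable u"
    unfolding u_def by (simp add: mult_ac)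
  have [measurable]: "ball (0::'a) r \<in> sets borel" for r
    by (simp add: borel_open)
  have "(\<integral>\<^sup>+ x. ennreal (exp (- norm (x::'a))) \<partial>lborel)
      \<le> (\<integral>\<^sup>+ x. (\<Sum>k. ennreal (exp (- real k)) * indicator (ball 0 (real (Suc k))) (x::'a)) \<partial>lborel)"
    by (intro nn_integral_mono layer)
  also have "\<dots> = (\<Sum>k. ennreal (exp (- real k)) * emeasure lborel (ball (0::'a) (real (Suc k))))"
    by (subst nn_integral_suminf) (simp_all add: nn_integral_cmult_indicator del: of_nat_Suc)
  also have "\<dots> = (\<Sum>k. ennreal (u k))"
    by (intro suminf_cong) (simp add: emeasure_ball u_def n_def ennreal_mult del: of_nat_Suc)
  also have "\<dots> = ennreal (suminf u)"
    by (intro suminf_ennreal2 u_nonneg \<open>summable u\<close>)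
  finally show ?thesis
    by (simp add: le_less_trans)
qed

text \<open>The integrand is zero only on the hyperplane orthogonal to \<open>e\<close>, which is negligible.\<close>

lemma nn_integral_direction_pos:
  fixes e :: "'a::euclidean_space"
  assumes "e \<in> Basis"
  shows "0 < (\<integral>\<^sup>+ y. ennreal (\<bar>sgn y \<bullet> e\<bar> powr p * exp (- norm y)) \<partial>lborel)"
proof (rule ccontr)
  assume "\<not> ?thesis"
  then have "(\<integral>\<^sup>+ y. ennreal (\<bar>sgn y \<bullet> e\<bar> powr p * exp (- norm y)) \<partial>lborel) = 0"
    by simp
  then have "AE y in lborel. ennreal (\<bar>sgn y \<bullet> e\<bar> powr p * exp (- norm y)) = 0"
    by (subst (asm) nn_integral_0_iff_AE) auto
  then have "AE y in lborel. e \<bullet> y = 0"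
    by (elim eventually_mono) (auto simp: sgn_div_norm inner_commute)
  moreover have "AE y in lborel. \<not> e \<bullet> y = 0"
    using AE_not_in[OF negligible_hyperplane[of e 0, unfolded negligible_iff_null_sets]] assms
    by (auto simp: AE_completion_iff nonzero_Basis)
  ultimately have "AE y in (lborel :: 'a measure). False"
    by eventually_elim auto
  then show False
    by (simp add: eventually_False ae_filter_eq_bot_iff)
qed

section \<open>Unboundedness of the functional\<close>

theorem proposition4p11:
  fixes p :: real
  assumes "CARD('n::finite) \<ge> 2" and "p > 1"
  shows "\<exists>K K' :: (real ^ 'n) set.
           convex_body K \<and> convex_body K' \<and> 0 \<in> interior (K \<inter> K') \<and>
           F_functional p K < F_functional p K'"
proof -
  obtain e :: "real ^ 'n" where e: "e \<in> Basis"
    using nonempty_Basis by blast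
  define I :: ennreal where "I = (\<integral>\<^sup>+ y. ennreal (\<bar>sgn y \<bullet> e\<bar> powr p * exp (- norm y)) \<partial>lborel)"
  define c :: "real \<Rightarrow> real ^ 'n \<Rightarrow> real" where "c a j = (if j = e then a else 1)" for a j
  \<comment> \<open>The gradient contributes a factor \<open>a powr p\<close>, and the determinant takes one power of \<open>a\<close> away.\<close>
  have lower: "ennreal (a powr (p - 1)) * I \<le> F_functional p (ellipsoid (c a))" if "a > 0" for a
  proof -
    have norm_ge: "a * \<bar>z \<bullet> e\<bar> \<le> norm (diagonal_map (c a) z)" for z
      using Basis_le_norm[OF e, of "diagonal_map (c a) z"] e \<open>a > 0\<close> by (simp add: c_def abs_mult)
    have prod: "(\<Prod>j\<in>Basis. \<bar>c a j\<bar>) = a"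
      using e \<open>a > 0\<close> by (simp add: c_def if_distrib prod.delta cong: if_cong)
    have "ennreal a * (ennreal (a powr (p - 1)) * I) = ennreal (a powr p) * I"
      using \<open>a > 0\<close> by (simp add: powr_diff flip: mult.assoc ennreal_mult)
    also have "\<dots> = (\<integral>\<^sup>+ y. ennreal ((a * \<bar>sgn y \<bullet> e\<bar>) powr p * exp (- norm y)) \<partial>lborel)"
      unfolding I_def using \<open>a > 0\<close>
      by (subst nn_integral_cmult [symmetric]) (simp_all add: powr_mult mult.assoc flip: ennreal_mult)
    also have "\<dots> \<le> (\<integral>\<^sup>+ y. ennreal (norm (diagonal_map (c a) (sgn y)) powr p * exp (- norm y)) \<partial>lborel)"
      using \<open>a > 0\<close> \<open>p > 1\<close>
      by (intro nn_integral_mono ennreal_leI mult_right_mono powr_mono2 norm_ge) auto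
    also have "\<dots> = ennreal (\<Prod>j\<in>Basis. \<bar>c a j\<bar>) * F_functional p (ellipsoid (c a))"
      using \<open>a > 0\<close> by (subst F_functional_ellipsoid) (simp_all add: c_def)
    finally show ?thesis
      using \<open>a > 0\<close> by (simp add: prod ennreal_mult_le_mult_iff)
  qed
  \<comment> \<open>Equal weights \<open>1\<close> describe the unit ball.\<close>
  have "F_functional p (ellipsoid (\<lambda>_::real ^ 'n. 1))
      = (\<integral>\<^sup>+ y. ennreal (norm (sgn (y::real ^ 'n)) powr p * exp (- norm y)) \<partial>lborel)"
    using F_functional_ellipsoid[where c = "\<lambda>_::real ^ 'n. 1" and p = p] by simp
  also have "\<dots> \<le> (\<integral>\<^sup>+ y. ennreal (exp (- norm (y::real ^ 'n))) \<partial>lborel)"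
    by (intro nn_integral_mono ennreal_leI) (simp add: norm_sgn)
  also have "\<dots> < \<infinity>"
    by (rule nn_integral_exp_minus_norm_finite)
  finally obtain M where M: "M \<ge> 0" "F_functional p (ellipsoid (\<lambda>_::real ^ 'n. 1)) = ennreal M"
    by (cases "F_functional p (ellipsoid (\<lambda>_::real ^ 'n. 1))") auto
  have "I > 0"
    unfolding I_def using e by (rule nn_integral_direction_pos)
  then obtain s where s: "0 < s" "s < I"
    using dense by blast
  then obtain r where r: "0 < r" "ennreal r < I"
    by (cases s) (auto simp: top.not_eq_extremum)
  \<comment> \<open>Chosen so that \<open>a powr (p - 1) * r = M + 1\<close>, which exceeds the value \<open>M\<close> of the unit ball.\<close>
  define a where "a = ((M + 1) / r) powr (1 / (p - 1))"
  have "a > 0" and a: "a powr (p - 1) = (M + 1) / r"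
    using r M \<open>p > 1\<close> by (auto simp: a_def powr_powr)
  have "ennreal M < ennreal ((M + 1) / r) * ennreal r"
    using r M by (simp add: ennreal_less_iff flip: ennreal_mult)
  also have "\<dots> \<le> ennreal ((M + 1) / r) * I"
    using r by (intro mult_left_mono) auto
  also have "\<dots> \<le> F_functional p (ellipsoid (c a))"
    using lower[OF \<open>a > 0\<close>] by (simp add: a)
  finally have "F_functional p (ellipsoid (\<lambda>_::real ^ 'n. 1)) < F_functional p (ellipsoid (c a))"
    by (simp add: M)
  moreover have "0 \<in> interior (ellipsoid (\<lambda>_::real ^ 'n. 1) \<inter> ellipsoid (c a))"
    using \<open>a > 0\<close> by (auto simp: c_def intro!: zero_in_interior_ellipsoid split: if_splits)
  ultimately show ?thesis
    using convex_body_ellipsoid by blast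
qed

end
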